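(* Let $G=(V,E)$ be a finite simple graph with $E\neq\emptyset$ and let $p$ be a positive integer. If $\gamma_p(G)>p$, then $r_p(G)=\eta_p(G)$.
   Context: For $x\in V$, $N_G(x)$ is the set of neighbours of $x$. A set $D\subseteq V$ is a $p$-dominating set if every vertex $x\notin D$ satisfies $|N_G(x)\cap D|\ge p$; $\gamma_p(G)$ is the minimum size of a $p$-dominating set. $G^c$ denotes the complement of $G$, and for $B\subseteq E(G^c)$, $G+B$ is the graph $(V,E\cup B)$. The $p$-reinforcement number is $r_p(G)=\min\{|B| : B\subseteq E(G^c),\ \gamma_p(G+B)<\gamma_p(G)\}$, with the convention $r_p(G)=0$ if $\gamma_p(G)\le p$. For $X\subseteq V$ and $x\in V$, define $\eta_p(x,X,G)=p-|N_G(x)\cap X|$ if $x\notin X$ and $|N_G(x)\cap X|<p$, and $\eta_p(x,X,G)=0$ otherwise. Define $\eta_p(G)=\min\{\sum_{x\in V}\eta_p(x,X,G) : X\subseteq V,\ |X|<\gamma_p(G)\}$. *)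

theory Defs
  imports "HOL-Library.Ramsey"
begin

text \<open>
  A graph is given by its vertex set \<open>V\<close> and its set \<open>E\<close> of edges, an edge being the two-element
  set of its end vertices; \<open>[V]\<^bsup>2\<^esup>\<close> is the set of all two-element subsets of \<open>V\<close>.
\<close>

definition fin_simple_graph :: "'a set \<Rightarrow> 'a set set \<Rightarrow> bool" where
  "fin_simple_graph V E \<longleftrightarrow> finite V \<and> E \<subseteq> [V]\<^bsup>2\<^esup>"

definition nbhd :: "'a set \<Rightarrow> 'a set set \<Rightarrow> 'a \<Rightarrow> 'a set" where
  "nbhd V E x = {y \<in> V. {x, y} \<in> E}"

definition compl_edges :: "'a set \<Rightarrow> 'a set set \<Rightarrow> 'a set set" where
  "compl_edges V E = [V]\<^bsup>2\<^esup> - E"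

definition p_dominating :: "nat \<Rightarrow> 'a set \<Rightarrow> 'a set set \<Rightarrow> 'a set \<Rightarrow> bool" where
  "p_dominating p V E D \<longleftrightarrow> D \<subseteq> V \<and> (\<forall>x \<in> V - D. card (nbhd V E x \<inter> D) \<ge> p)"

definition p_domination_number :: "nat \<Rightarrow> 'a set \<Rightarrow> 'a set set \<Rightarrow> nat" where
  "p_domination_number p V E = Min {card D | D. p_dominating p V E D}"

text \<open>
  The set under \<open>Min\<close> below is nonempty whenever the \<open>p\<close>-domination number exceeds \<open>p\<close>: adding all
  missing edges yields a complete graph on more than \<open>p\<close> vertices.
\<close>

definition p_reinforcement_number :: "nat \<Rightarrow> 'a set \<Rightarrow> 'a set set \<Rightarrow> nat" where
  "p_reinforcement_number p V E =
     (if p_domination_number p V E \<le> p then 0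
      else Min {card B | B. B \<subseteq> compl_edges V E \<and>
                  p_domination_number p V (E \<union> B) < p_domination_number p V E})"

definition eta_vertex :: "nat \<Rightarrow> 'a \<Rightarrow> 'a set \<Rightarrow> 'a set \<Rightarrow> 'a set set \<Rightarrow> nat" where
  "eta_vertex p x X V E =
     (if x \<notin> X \<and> card (nbhd V E x \<inter> X) < p then p - card (nbhd V E x \<inter> X) else 0)"

definition eta :: "nat \<Rightarrow> 'a set \<Rightarrow> 'a set set \<Rightarrow> nat" where
  "eta p V E =
     Min {(\<Sum>x\<in>V. eta_vertex p x X V E) | X. X \<subseteq> V \<and> card X < p_domination_number p V E}"

end

theory Submission
  imports Defs
begin

text \<open>
  The deficiency of \<open>X\<close>, the sum of the \<open>\<eta>\<^sub>p(x, X, G)\<close>, is the least number of edges that must be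
  added to make \<open>X\<close> a \<open>p\<close>-dominating set: every added edge joining \<open>X\<close> to its complement lowers the
  deficiency by at most one, and if \<open>|X| \<ge> p\<close> there are enough non-neighbours in \<open>X\<close> to attain it.
  A smaller \<open>X\<close> may be enlarged to \<open>p\<close> vertices: this does not increase the deficiency, and the
  set stays below \<open>\<gamma>\<^sub>p(G)\<close> because \<open>\<gamma>\<^sub>p(G) > p\<close>.
\<close>

lemma p_dominating_vertex_set: "p_dominating p V E V"
  by (simp add: p_dominating_def)

lemma finite_p_dominating_cards:
  assumes "finite V"
  shows "finite {card D | D. p_dominating p V E D}"
proof -
  have "{card D | D. p_dominating p V E D} \<subseteq> card ` Pow V"
    by (auto simp: p_dominating_def)
  then show ?thesis
    using assms by (meson finite_Pow_iff finite_imageI finite_subset)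
qed

lemma p_domination_number_le:
  assumes "finite V" "p_dominating p V E D"
  shows "p_domination_number p V E \<le> card D"
  unfolding p_domination_number_def
  using assms(2) by (intro Min_le finite_p_dominating_cards[OF assms(1)]) blast

lemma p_domination_number_attained:
  assumes "finite V"
  obtains D where "p_dominating p V E D" "card D = p_domination_number p V E"
proof -
  have "{card D | D. p_dominating p V E D} \<noteq> {}"
    using p_dominating_vertex_set by fastforce
  from Min_in[OF finite_p_dominating_cards[OF assms] this]
  obtain D where "p_dominating p V E D" "p_domination_number p V E = card D"
    unfolding p_domination_number_def by blast
  with that show ?thesis
    by simp
qed

lemma eta_vertex_in [simp]: "x \<in> X \<Longrightarrow> eta_vertex p x X V E = 0"
  by (simp add: eta_vertex_def)

text \<open>Subtraction on \<open>nat\<close> is truncated at 0, which absorbs the case of at least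
  \<open>p\<close> neighbours in \<open>X\<close>.\<close>

lemma eta_vertex_notin: "x \<notin> X \<Longrightarrow> eta_vertex p x X V E = p - card (nbhd V E x \<inter> X)"
  by (simp add: eta_vertex_def)

lemma eta_vertex_antimono:
  assumes "finite Y" "X \<subseteq> Y"
  shows "eta_vertex p x Y V E \<le> eta_vertex p x X V E"
proof (cases "x \<in> Y")
  case False
  have "card (nbhd V E x \<inter> X) \<le> card (nbhd V E x \<inter> Y)"
    using assms by (intro card_mono) auto
  with False assms(2) show ?thesis
    by (metis diff_le_mono2 eta_vertex_notin subsetD)
qed simp

text \<open>A charging argument: a vertex outside \<open>D\<close> makes up its deficiency by edges
  of \<open>B\<close> into \<open>D\<close>. Such an edge has only one end outside \<open>D\<close>,
  so no edge is charged to two vertices.\<close>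

lemma eta_sum_le_card_added_edges:
  assumes "finite V" "finite B" and dom: "p_dominating p V (E \<union> B) D"
  shows "(\<Sum>x\<in>V. eta_vertex p x D V E) \<le> card B"
proof -
  have "finite D"
    using assms(1) dom by (auto simp: p_dominating_def intro: finite_subset)
  \<comment> \<open>\<open>S x\<close> collects the edges charged to \<open>x\<close>. It is empty
    on \<open>D\<close>, since an edge of \<open>B\<close> inside \<open>D\<close> would otherwise
    be charged to both of its ends and the disjointness of the family would fail.\<close>
  define S where "S x = (if x \<in> D then {} else (\<lambda>y. {x, y}) ` {y \<in> D. {x, y} \<in> B})" for x
  have "eta_vertex p x D V E \<le> card (S x)" if "x \<in> V" for x
  proof (cases "x \<in> D")
    case False
    have "p \<le> card (nbhd V (E \<union> B) x \<inter> D)"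
      using dom that False by (simp add: p_dominating_def)
    also have "\<dots> \<le> card ((nbhd V E x \<inter> D) \<union> {y \<in> D. {x, y} \<in> B})"
      using \<open>finite D\<close> by (intro card_mono) (auto simp: nbhd_def)
    also have "\<dots> \<le> card (nbhd V E x \<inter> D) + card {y \<in> D. {x, y} \<in> B}"
      by (rule card_Un_le)
    also have "card {y \<in> D. {x, y} \<in> B} = card (S x)"
      using False by (simp add: S_def card_image inj_on_def doubleton_eq_iff)
    finally show ?thesis
      using False by (simp add: eta_vertex_notin)
  qed simp
  then have "(\<Sum>x\<in>V. eta_vertex p x D V E) \<le> (\<Sum>x\<in>V. card (S x))"
    by (rule sum_mono)
  also have "\<dots> = card (\<Union>x\<in>V. S x)"
    using \<open>finite V\<close> \<open>finite D\<close>
    by (intro card_UN_disjoint[symmetric]) (auto simp: S_def doubleton_eq_iff)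
  also have "\<dots> \<le> card B"
    using \<open>finite B\<close> by (intro card_mono) (auto simp: S_def split: if_splits)
  finally show ?thesis .
qed

text \<open>Each deficient vertex is joined to as many of its non-neighbours in \<open>X\<close> as
  its deficiency demands. The bound \<open>p \<le> card X\<close> guarantees that enough of them
  exist.\<close>

lemma p_dominating_by_adding_eta_sum_edges:
  assumes "finite V" "X \<subseteq> V" "p \<le> card X"
  obtains B where "B \<subseteq> compl_edges V E" "p_dominating p V (E \<union> B) X"
    "card B \<le> (\<Sum>x\<in>V. eta_vertex p x X V E)"
proof -
  have "finite X"
    using assms finite_subset by blast
  \<comment> \<open>Outside \<open>X\<close>, the supply is
    \<open>card X - card (nbhd V E x \<inter> X)\<close> and the demand
    \<open>p - card (nbhd V E x \<inter> X)\<close>; inside \<open>X\<close> the demand is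
    0.\<close>
  have "\<exists>F \<subseteq> X - nbhd V E x. card F = eta_vertex p x X V E" for x
  proof -
    have "card (X - nbhd V E x) = card X - card (nbhd V E x \<inter> X)"
      using \<open>finite X\<close> by (simp add: card_Diff_subset_Int Int_commute)
    then have "eta_vertex p x X V E \<le> card (X - nbhd V E x)"
      using assms(3) by (auto simp: eta_vertex_def)
    then show ?thesis
      by (meson obtain_subset_with_card_n)
  qed
  then obtain F where F: "\<And>x. F x \<subseteq> X - nbhd V E x" "\<And>x. card (F x) = eta_vertex p x X V E"
    by metis
  have finF: "finite (F x)" for x
    using F(1) \<open>finite X\<close> by (meson finite_Diff finite_subset)
  \<comment> \<open>Hence new edges start only outside \<open>X\<close> and end in \<open>X\<close>,
    so that \<open>{x, y}\<close> is never a singleton.\<close>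
  have F_empty: "F x = {}" if "x \<in> X" for x
    using F(2)[of x] finF that by simp
  define B where "B = (\<Union>x\<in>V. (\<lambda>y. {x, y}) ` F x)"
  have "B \<subseteq> compl_edges V E"
  proof
    fix e assume "e \<in> B"
    then obtain x y where xy: "x \<in> V" "y \<in> F x" "e = {x, y}"
      by (auto simp: B_def)
    then have "y \<in> X" "y \<notin> nbhd V E x" "x \<notin> X"
      using F(1) F_empty by blast+
    then show "e \<in> compl_edges V E"
      using xy assms(2) by (auto simp: compl_edges_def nbhd_def nsets_def card_2_iff)
  qed
  moreover have "p_dominating p V (E \<union> B) X"
    unfolding p_dominating_def
  proof (intro conjI ballI assms(2))
    fix x assume x: "x \<in> V - X"
    have "p \<le> card (nbhd V E x \<inter> X) + card (F x)"
      using x by (simp add: F(2) eta_vertex_notin)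
    also have "\<dots> = card ((nbhd V E x \<inter> X) \<union> F x)"
      using F(1)[of x] finF \<open>finite X\<close> by (intro card_Un_disjoint[symmetric]) auto
    also have "\<dots> \<le> card (nbhd V (E \<union> B) x \<inter> X)"
      using F(1)[of x] x assms(2) \<open>finite X\<close>
      by (intro card_mono) (auto simp: nbhd_def B_def)
    finally show "p \<le> card (nbhd V (E \<union> B) x \<inter> X)" .
  qed
  moreover have "card B \<le> (\<Sum>x\<in>V. eta_vertex p x X V E)"
  proof -
    have "card B \<le> (\<Sum>x\<in>V. card ((\<lambda>y. {x, y}) ` F x))"
      unfolding B_def using assms(1) by (rule card_UN_le)
    also have "\<dots> \<le> (\<Sum>x\<in>V. eta_vertex p x X V E)"
      using F(2) finF by (metis (no_types, lifting) card_image_le sum_mono)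
    finally show ?thesis .
  qed
  ultimately show thesis
    by (rule that)
qed

lemma enlarge_to_card:
  assumes "finite V" "X \<subseteq> V" "p \<le> card V"
  obtains Y where "X \<subseteq> Y" "Y \<subseteq> V" "card Y = max p (card X)"
proof -
  have "card X \<le> card V"
    using assms by (simp add: card_mono)
  then show thesis
    using that exists_subset_between[of X "max p (card X)" V] assms by auto
qed

theorem theorem2p2:
  fixes V :: "'a set" and E :: "'a set set" and p :: nat
  assumes "fin_simple_graph V E"
    and "E \<noteq> {}"
    and "p > 0"
    and "p_domination_number p V E > p"
  shows "p_reinforcement_number p V E = eta p V E"
proof -
  let ?g = "p_domination_number p V E"
  let ?R = "{card B | B. B \<subseteq> compl_edges V E \<and> p_domination_number p V (E \<union> B) < ?g}"
  let ?H = "{(\<Sum>x\<in>V. eta_vertex p x X V E) | X. X \<subseteq> V \<and> card X < ?g}"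
  have "finite V"
    using assms(1) by (simp add: fin_simple_graph_def)
  have fin_compl: "finite (compl_edges V E)"
    unfolding compl_edges_def using \<open>finite V\<close> by (simp add: finite_imp_finite_nsets)
  have "?R \<subseteq> card ` Pow (compl_edges V E)"
    by auto
  then have finR: "finite ?R"
    using fin_compl by (meson finite_Pow_iff finite_imageI finite_subset)
  have "?H \<subseteq> (\<lambda>X. \<Sum>x\<in>V. eta_vertex p x X V E) ` Pow V"
    by auto
  then have finH: "finite ?H"
    using \<open>finite V\<close> by (meson finite_Pow_iff finite_imageI finite_subset)
  have "p \<le> card V"
    using p_domination_number_le[OF \<open>finite V\<close> p_dominating_vertex_set, of p E] assms(4) by linarith
  \<comment> \<open>Two nonempty finite sets of numbers have the same minimum if every element of
    either one has an element of the other below or equal to it. \<open>R_le\<close> and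
    \<open>H_le\<close> provide the two directions.\<close>
  have R_le: "\<exists>r\<in>?R. r \<le> h" if "h \<in> ?H" for h
  proof -
    from that obtain X where X: "X \<subseteq> V" "card X < ?g" "h = (\<Sum>x\<in>V. eta_vertex p x X V E)"
      by blast
    obtain Y where Y: "X \<subseteq> Y" "Y \<subseteq> V" "card Y = max p (card X)"
      using enlarge_to_card[OF \<open>finite V\<close> X(1) \<open>p \<le> card V\<close>] .
    obtain B where B: "B \<subseteq> compl_edges V E" "p_dominating p V (E \<union> B) Y"
      "card B \<le> (\<Sum>x\<in>V. eta_vertex p x Y V E)"
      using p_dominating_by_adding_eta_sum_edges[OF \<open>finite V\<close> Y(2), of p E] Y(3) by auto
    have "p_domination_number p V (E \<union> B) \<le> card Y"
      by (rule p_domination_number_le[OF \<open>finite V\<close> B(2)])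
    also have "\<dots> < ?g"
      using X(2) Y(3) assms(4) by simp
    finally have "card B \<in> ?R"
      using B(1) by blast
    moreover have "(\<Sum>x\<in>V. eta_vertex p x Y V E) \<le> h"
      unfolding X(3) using Y \<open>finite V\<close> by (intro sum_mono eta_vertex_antimono) (auto intro: finite_subset)
    ultimately show ?thesis
      using B(3) le_trans by blast
  qed
  have H_le: "\<exists>h\<in>?H. h \<le> r" if "r \<in> ?R" for r
  proof -
    from that obtain B where B: "B \<subseteq> compl_edges V E" "p_domination_number p V (E \<union> B) < ?g"
      "r = card B"
      by blast
    \<comment> \<open>A minimum \<open>p\<close>-dominating set of the enlarged graph has fewer than
      \<open>?g\<close> vertices, so it is one of the sets over which \<open>eta\<close>
      minimises.\<close>
    obtain D where D: "p_dominating p V (E \<union> B) D" "card D = p_domination_number p V (E \<union> B)"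
      using p_domination_number_attained[OF \<open>finite V\<close>] .
    have "finite B"
      using B(1) fin_compl finite_subset by blast
    then have "(\<Sum>x\<in>V. eta_vertex p x D V E) \<le> r"
      unfolding B(3) using eta_sum_le_card_added_edges[OF \<open>finite V\<close> _ D(1)] by blast
    moreover have "D \<subseteq> V" "card D < ?g"
      using D B(2) by (auto simp: p_dominating_def)
    ultimately show ?thesis
      by blast
  qed
  \<comment> \<open>The empty set is admissible for \<open>eta\<close>; \<open>R_le\<close> then
    turns this element of \<open>?H\<close> into one of \<open>?R\<close>, so both minima are
    genuine.\<close>
  have "card {} < ?g"
    using assms(4) by simp
  then have neH: "?H \<noteq> {}"
    by blast
  with R_le have neR: "?R \<noteq> {}"
    by blast
  have "Min ?R = Min ?H"
  proof (rule antisym)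
    obtain r where "r \<in> ?R" "r \<le> Min ?H"
      using R_le[OF Min_in[OF finH neH]] by blast
    then show "Min ?R \<le> Min ?H"
      using Min_le[OF finR] le_trans by blast
  next
    obtain h where "h \<in> ?H" "h \<le> Min ?R"
      using H_le[OF Min_in[OF finR neR]] by blast
    then show "Min ?H \<le> Min ?R"
      using Min_le[OF finH] le_trans by blast
  qed
  then show ?thesis
    using assms(4) by (simp add: p_reinforcement_number_def eta_def)
qed

end
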